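(* Let $\Bbbk$ be a field of characteristic $0$ and let $n\geq2$. The triple algebra $\mathfrak{T}(\mathbb{E}^n(\Bbbk))\simeq\mathbb{E}^3(\Bbbk)\otimes_{\Bbbk}\mathbb{E}^n(\Bbbk)$ is a simple Killing metrized exact commutative algebra that is not isomorphic to $\mathbb{E}^{3n}(\Bbbk)$.
   Context: An algebra is a finite-dimensional vector space with bilinear multiplication, not assumed unital or associative; $L_\circ(x)y=x\circ y$. A commutative algebra is exact if $\operatorname{tr}L_\circ(x)=0$ for all $x$; it is Killing metrized if its Killing form $\tau_\circ(x,y)=\operatorname{tr}L_\circ(x)L_\circ(y)$ is nondegenerate and invariant, i.e. $\tau_\circ(x\circ y,z)=\tau_\circ(x,y\circ z)$. An algebra is simple if its multiplication is not identically zero and it has no nonzero proper ideal. For $n\geq2$, the simplicial algebra $\mathbb{E}^n(\Bbbk)$ is the $n$-dimensional commutative algebra spanned by $\gamma_0,\dots,\gamma_n$ with $\sum_{i=0}^n\gamma_i=0$ (any $n$ of the $\gamma_i$ forming a basis), $\gamma_i\circ\gamma_i=\gamma_i$, and $\gamma_i\circ\gamma_j=-\tfrac1{n-1}(\gamma_i+\gamma_j)$ for $i\neq j$. The triple of an algebra $(\mathbb{A},\circ)$ is $\mathfrak{T}(\mathbb{A})=\mathbb{A}\oplus\mathbb{A}\oplus\mathbb{A}$ with $$x\odot y=\tfrac12\big(x_2\circ y_3+y_2\circ x_3,\;x_3\circ y_1+y_3\circ x_1,\;x_1\circ y_2+y_1\circ x_2\big).$$ The tensor product of commutative algebras carries the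 product determined by $(a_1\otimes b_1)(a_2\otimes b_2)=(a_1a_2)\otimes(b_1b_2)$. *)

theory Defs
  imports "HOL-Analysis.Analysis"
begin

section \<open>Finite-dimensional algebras\<close>

text \<open>
  The vector space is the whole type \<open>'a\<close>, with the scalar multiplication as a parameter, as in
  \<^theory>\<open>HOL.Vector_Spaces\<close>.
\<close>

locale fd_vector_space = vector_space scale
  for scale :: "'k::field \<Rightarrow> 'a::ab_group_add \<Rightarrow> 'a" +
  assumes finite_dim: "\<exists>B. finite B \<and> span B = UNIV"
begin

text \<open>
  The trace is computed in the basis \<open>extend_basis {}\<close>. Every other basis gives the same value, see
  \<open>endo_trace_eq\<close>.
\<close>

definition endo_trace :: "('a \<Rightarrow> 'a) \<Rightarrow> 'k" where
  "endo_trace f = (\<Sum>b\<in>extend_basis {}. representation (extend_basis {}) (f b) b)"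

lemma independent_finite: "independent B \<Longrightarrow> finite B"
  using finite_dim independent_span_bound by blast

lemma trace_sum_indep_basis:
  assumes f: "Vector_Spaces.linear scale scale f"
    and B: "independent B" "span B = UNIV"
    and C: "independent C" "span C = UNIV"
  shows "(\<Sum>b\<in>B. representation B (f b) b) = (\<Sum>c\<in>C. representation C (f c) c)"
proof -
  have "finite B" "finite C" using B C by (auto intro: independent_finite)
  note B = this(1) B and C = this(2) C
  interpret f: Vector_Spaces.linear scale scale f by (rule f)
  have expB: "(\<Sum>b\<in>B. scale (representation B v b) b) = v" for v
    using B by (intro sum_representation_eq) auto
  have expC: "(\<Sum>c\<in>C. scale (representation C v c) c) = v" for v
    using C by (intro sum_representation_eq) auto
  have repB: "representation B (f b) b = (\<Sum>c\<in>C. representation C b c * representation B (f c) b)" for b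
  proof -
    have "f b = f (\<Sum>c\<in>C. scale (representation C b c) c)" by (simp add: expC)
    also have "\<dots> = (\<Sum>c\<in>C. scale (representation C b c) (f c))" by (simp add: f.sum f.scale)
    finally have "representation B (f b) b
        = representation B (\<Sum>c\<in>C. scale (representation C b c) (f c)) b" by simp
    also have "\<dots> = (\<Sum>c\<in>C. representation C b c * representation B (f c) b)"
      using B by (simp add: representation_sum representation_scale)
    finally show ?thesis .
  qed
  have repC: "representation C (f c) c = (\<Sum>b\<in>B. representation B (f c) b * representation C b c)" for c
  proof -
    have "representation C (f c) c
        = representation C (\<Sum>b\<in>B. scale (representation B (f c) b) b) c" by (simp add: expB)
    also have "\<dots> = (\<Sum>b\<in>B. representation B (f c) b * representation C b c)"
      using C by (simp add: representation_sum representation_scale)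
    finally show ?thesis .
  qed
  show ?thesis unfolding repB repC by (subst sum.swap) (simp add: mult.commute)
qed

lemma endo_trace_eq:
  assumes "Vector_Spaces.linear scale scale f" "independent B" "span B = UNIV"
  shows "endo_trace f = (\<Sum>b\<in>B. representation B (f b) b)"
  unfolding endo_trace_def using assms
  by (intro trace_sum_indep_basis) (simp_all add: independent_extend_basis independent_empty)

end

locale fd_algebra = fd_vector_space scale
  for scale :: "'k::field \<Rightarrow> 'a::ab_group_add \<Rightarrow> 'a" +
  fixes mult :: "'a \<Rightarrow> 'a \<Rightarrow> 'a"
  assumes linear_mult_left: "Vector_Spaces.linear scale scale (\<lambda>y. mult x y)"
    and linear_mult_right: "Vector_Spaces.linear scale scale (\<lambda>x. mult x y)"
begin

definition killing_form :: "'a \<Rightarrow> 'a \<Rightarrow> 'k" where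
  "killing_form x y = endo_trace (mult x \<circ> mult y)"

definition ideal :: "'a set \<Rightarrow> bool" where
  "ideal I \<longleftrightarrow> subspace I \<and> (\<forall>a. \<forall>x\<in>I. mult a x \<in> I \<and> mult x a \<in> I)"

end

locale commutative_algebra = fd_algebra +
  assumes mult_commute: "mult x y = mult y x"

locale exact_commutative_algebra = commutative_algebra +
  assumes exact: "endo_trace (mult x) = 0"

locale killing_metrized_algebra = fd_algebra +
  assumes killing_nondegenerate: "(\<And>y. killing_form x y = 0) \<Longrightarrow> x = 0"
    and killing_invariant: "killing_form (mult x y) z = killing_form x (mult y z)"

locale simple_algebra = fd_algebra +
  assumes mult_nonzero: "\<exists>x y. mult x y \<noteq> 0"
    and ideal_trivial: "ideal I \<Longrightarrow> I = {0} \<or> I = UNIV"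

definition algebra_isomorphic ::
  "('k::field \<Rightarrow> 'a::ab_group_add \<Rightarrow> 'a) \<Rightarrow> ('a \<Rightarrow> 'a \<Rightarrow> 'a) \<Rightarrow>
   ('k \<Rightarrow> 'b::ab_group_add \<Rightarrow> 'b) \<Rightarrow> ('b \<Rightarrow> 'b \<Rightarrow> 'b) \<Rightarrow> bool" where
  "algebra_isomorphic s1 m1 s2 m2 \<longleftrightarrow>
     (\<exists>f. Vector_Spaces.linear s1 s2 f \<and> bij f \<and> (\<forall>x y. f (m1 x y) = m2 (f x) (f y)))"


section \<open>Simplicial algebras\<close>

text \<open>
  The algebra \<open>\<bbbE>\<^sup>n\<close> is realized on \<open>'k ^ 'n\<close>, where \<open>n = CARD('n)\<close>;
  so \<open>\<bbbE>\<^sup>3\<^sup>n\<close> can be taken on \<open>'k ^ (3 \<times> 'n)\<close>.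
  The \<open>n + 1\<close> generators of \<open>\<bbbE>\<^sup>n\<close> are
  indexed by \<open>'n option\<close>: those with index \<open>Some i\<close> are the standard basis vectors, and \<open>None\<close>
  is the remaining index, whose generator is minus the sum of the others. The multiplication is the
  bilinear extension of the relations among the \<open>simplex_gen (Some i)\<close>. The relations that involve
  the generator at \<open>None\<close> then follow, see \<open>simplicial_mult_gen\<close>.
\<close>

definition simplex_gen :: "'n option \<Rightarrow> 'k::field ^ 'n::finite" where
  "simplex_gen i = (case i of None \<Rightarrow> - (\<Sum>j\<in>UNIV. axis j 1) | Some j \<Rightarrow> axis j 1)"

definition simplicial_mult :: "'k::field ^ 'n \<Rightarrow> 'k ^ 'n \<Rightarrow> 'k ^ 'n::finite" where
  "simplicial_mult x y =
     (\<Sum>i\<in>UNIV. \<Sum>j\<in>UNIV. (x $ i * y $ j) *s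
        (if i = j then simplex_gen (Some i)
         else (- 1 / (of_nat CARD('n) - 1)) *s (simplex_gen (Some i) + simplex_gen (Some j))))"

lemma simplicial_mult_add_left: "simplicial_mult (x + x') y = simplicial_mult x y + simplicial_mult x' y"
  by (simp add: simplicial_mult_def distrib_right vec.scale_left_distrib sum.distrib)

lemma simplicial_mult_add_right: "simplicial_mult x (y + y') = simplicial_mult x y + simplicial_mult x y'"
  by (simp add: simplicial_mult_def distrib_left vec.scale_left_distrib sum.distrib)

lemma simplicial_mult_scale_left: "simplicial_mult (c *s x) y = c *s simplicial_mult x y"
  by (simp add: simplicial_mult_def vec.scale_sum_right mult.assoc)

lemma simplicial_mult_scale_right: "simplicial_mult x (c *s y) = c *s simplicial_mult x y"
  by (simp add: simplicial_mult_def vec.scale_sum_right mult_ac)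

lemma linear_simplicial_mult:
  "Vector_Spaces.linear (*s) (*s) (simplicial_mult x)"
  "Vector_Spaces.linear (*s) (*s) (\<lambda>x. simplicial_mult x y)"
  by (unfold_locales; simp add: simplicial_mult_add_left simplicial_mult_add_right
      simplicial_mult_scale_left simplicial_mult_scale_right)+

lemma simplicial_mult_commute: "simplicial_mult x y = simplicial_mult y x"
  unfolding simplicial_mult_def
  by (subst sum.swap) (intro sum.cong refl, simp add: mult.commute add.commute)

lemma commutative_algebra_simplicial: "commutative_algebra (*s) simplicial_mult"
proof -
  have "\<exists>B::('a, 'b) vec set. finite B \<and> vec.span B = UNIV"
    using finite_cart_basis span_cart_basis by blast
  then show ?thesis
    by unfold_locales (auto simp: simplicial_mult_add_left simplicial_mult_add_right
        simplicial_mult_scale_left simplicial_mult_scale_right simplicial_mult_commute)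
qed

lemma sum_simplex_gen: "(\<Sum>i\<in>UNIV. simplex_gen i) = 0"
  by (simp add: UNIV_option_conv sum.reindex simplex_gen_def)

lemma simplicial_mult_axis:
  "simplicial_mult (axis i 1) (axis j 1) =
     (if i = j then axis i 1
      else (- 1 / (of_nat CARD('n) - 1)) *s (axis i 1 + axis j (1::'k::field) :: 'k ^ 'n::finite))"
proof -
  have "simplicial_mult (axis i 1) (axis j (1::'k) :: 'k ^ 'n) =
     (\<Sum>k\<in>UNIV. \<Sum>l\<in>UNIV. if k = i then (if l = j then
        (if k = l then simplex_gen (Some k)
         else (- 1 / (of_nat CARD('n) - 1)) *s (simplex_gen (Some k) + simplex_gen (Some l))) else 0) else 0)"
    unfolding simplicial_mult_def by (intro sum.cong refl) (auto simp: axis_def)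
  also have "\<dots> = (\<Sum>k\<in>UNIV. if k = i then (\<Sum>l\<in>UNIV. if l = j then
        (if k = l then simplex_gen (Some k)
         else (- 1 / (of_nat CARD('n) - 1)) *s (simplex_gen (Some k) + simplex_gen (Some l))) else 0) else 0)"
    by (intro sum.cong refl) auto
  also have "\<dots> = (if i = j then axis i 1 else (- 1 / (of_nat CARD('n) - 1)) *s (axis i 1 + axis j 1))"
    by (simp add: simplex_gen_def)
  finally show ?thesis .
qed

lemma simplicial_mult_gen:
  fixes i j :: "'n::finite option"
  assumes n: "CARD('n) \<ge> 2"
  shows "simplicial_mult (simplex_gen i) (simplex_gen j) =
     (if i = j then simplex_gen i
      else (- 1 / (of_nat CARD('n) - 1)) *s
           (simplex_gen i + simplex_gen j :: 'k::field_char_0 ^ 'n))"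
proof -
  define N :: 'k where "N = of_nat CARD('n)"
  define c where "c = - 1 / (N - 1)"
  define S where "S = (\<Sum>k\<in>UNIV. axis k (1::'k) :: 'k ^ 'n)"
  have "N \<noteq> 1"
    using n of_nat_eq_iff[where 'a = 'k, of "CARD('n)" 1] by (simp add: N_def)
  then have c: "c * (N - 1) = -1"
    by (simp add: c_def)
  have ax: "simplicial_mult (axis a 1) (axis b 1) =
      (if a = b then axis a 1 else c *s (axis a 1 + axis b (1::'k) :: 'k ^ 'n))" for a b
    unfolding c_def N_def by (rule simplicial_mult_axis)
  interpret L: Vector_Spaces.linear "(*s)" "(*s)" "\<lambda>x::'k^'n. simplicial_mult x y" for y
    by (rule linear_simplicial_mult)
  interpret R: Vector_Spaces.linear "(*s)" "(*s)" "simplicial_mult (x::'k^'n)" for x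
    by (rule linear_simplicial_mult)
  have aS: "simplicial_mult (axis a 1) S = c *s S - c *s axis a 1" for a :: 'n
  proof -
    have "simplicial_mult (axis a 1) S = (\<Sum>k\<in>UNIV. simplicial_mult (axis a 1) (axis k 1))"
      unfolding S_def by (rule R.sum)
    also have "\<dots> = axis a 1 + (\<Sum>k\<in>UNIV - {a}. c *s (axis a 1 + axis k 1))"
      by (subst sum.remove[of _ a]) (auto simp: ax intro!: sum.cong)
    also have "(\<Sum>k\<in>UNIV - {a}. c *s (axis a 1 + axis k (1::'k) :: 'k^'n))
        = (\<Sum>k\<in>UNIV. c *s (axis a 1 + axis k 1)) - c *s (axis a 1 + axis a 1)"
      by (simp only: sum_diff1 finite UNIV_I if_True)
    also have "(\<Sum>k\<in>UNIV. c *s (axis a 1 + axis k (1::'k) :: 'k^'n)) = c *s (N *s axis a 1 + S)"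
      by (simp add: vec.scale_sum_right[symmetric] sum.distrib S_def N_def vec.sum_constant_scale
          del: sum_constant)
    also have "axis a 1 + (c *s (N *s axis a 1 + S) - c *s (axis a 1 + axis a 1))
        = (1 + c * (N - 1)) *s axis a 1 + (c *s S - c *s axis a 1)"
      by (simp add: vec_eq_iff algebra_simps)
    finally show ?thesis by (simp add: c)
  qed
  have SS: "simplicial_mult S S = - S"
  proof -
    have "simplicial_mult S S = (\<Sum>a\<in>UNIV. simplicial_mult (axis a 1) S)"
      using L.sum[of "\<lambda>a. axis a 1" UNIV S] by (simp add: S_def)
    also have "\<dots> = (\<Sum>a::'n\<in>UNIV. c *s S) - c *s S"
      unfolding aS by (simp add: sum_subtractf vec.scale_sum_right[symmetric] S_def)
    also have "\<dots> = (c * (N - 1)) *s S"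
      by (simp add: vec.sum_constant_scale vec_eq_iff N_def algebra_simps del: sum_constant)
    finally show ?thesis by (simp add: c)
  qed
  have Sa: "simplicial_mult S (axis a 1) = c *s S - c *s axis a 1" for a :: 'n
    using aS[of a] by (simp add: simplicial_mult_commute)
  have gen: "simplex_gen None = - S" "simplex_gen (Some a) = axis a 1" for a :: 'n
    by (simp_all add: simplex_gen_def S_def)
  have "simplicial_mult (simplex_gen i) (simplex_gen j) =
     (if i = j then simplex_gen i else c *s (simplex_gen i + simplex_gen j))"
    by (cases i; cases j)
      (simp_all add: gen ax L.neg R.neg aS Sa SS vec.scale_right_distrib)
  then show ?thesis by (simp only: c_def N_def)
qed

text \<open>The images of the \<open>n\<close> indices other than \<open>i\<close> form a basis.\<close>

lemma simplex_gen_basis: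
  fixes i :: "'n::finite option"
  defines "B \<equiv> (simplex_gen ` (UNIV - {i}) :: ('k::field_char_0 ^ 'n) set)"
  shows "inj_on (simplex_gen :: _ \<Rightarrow> 'k ^ 'n) (UNIV - {i})"
    and "vec.independent B" and "vec.span B = UNIV"
proof -
  have fin: "finite B" by (simp add: B_def)
  have in_span: "simplex_gen j \<in> vec.span B" for j
  proof (cases "j = i")
    case True
    have "simplex_gen i + (\<Sum>k\<in>UNIV - {i}. simplex_gen k) = (0 :: 'k^'n)"
      using sum_simplex_gen by (subst sum.remove[symmetric]) auto
    then have "simplex_gen i = - (\<Sum>k\<in>UNIV - {i}. simplex_gen k :: 'k^'n)"
      by (simp add: eq_neg_iff_add_eq_0)
    moreover have "(\<Sum>k\<in>UNIV - {i}. simplex_gen k :: 'k^'n) \<in> vec.span B"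
      by (intro vec.span_sum vec.span_base) (auto simp: B_def)
    ultimately show ?thesis using True by (simp add: vec.span_neg)
  qed (auto simp: B_def intro!: vec.span_base)
  have "cart_basis \<subseteq> vec.span B"
    using in_span[of "Some _"] by (auto simp: cart_basis_def simplex_gen_def)
  then have "vec.span cart_basis \<subseteq> vec.span B"
    by (rule vec.span_minimal) (rule vec.subspace_span)
  then show sp: "vec.span B = UNIV" by auto
  have cardU: "card (UNIV - {i}) = CARD('n)"
    by (simp add: card_Diff_singleton)
  have dim: "vec.dim (UNIV :: ('k^'n) set) = CARD('n)"
    by (simp add: card_cart_basis)
  have "CARD('n) \<le> card B"
    using vec.dim_le_card[of UNIV B] sp fin dim by simp
  moreover have "card B \<le> card (UNIV - {i})"
    unfolding B_def by (rule card_image_le) simp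
  ultimately have cardB: "card B = CARD('n)" "card B = card (UNIV - {i})"
    using cardU by auto
  then show "inj_on (simplex_gen :: _ \<Rightarrow> 'k ^ 'n) (UNIV - {i})"
    unfolding B_def by (intro eq_card_imp_inj_on) auto
  show "vec.independent B"
    by (rule vec.card_le_dim_spanning[of _ UNIV]) (use sp fin cardB dim in auto)
qed


section \<open>The triple of an algebra\<close>

fun triple_scale :: "('k \<Rightarrow> 'a \<Rightarrow> 'a) \<Rightarrow> 'k \<Rightarrow> 'a \<times> 'a \<times> 'a \<Rightarrow> 'a \<times> 'a \<times> 'a" where
  "triple_scale s c (x1, x2, x3) = (s c x1, s c x2, s c x3)"

fun triple_mult :: "('k::field \<Rightarrow> 'a::ab_group_add \<Rightarrow> 'a) \<Rightarrow> ('a \<Rightarrow> 'a \<Rightarrow> 'a) \<Rightarrow>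
    'a \<times> 'a \<times> 'a \<Rightarrow> 'a \<times> 'a \<times> 'a \<Rightarrow> 'a \<times> 'a \<times> 'a" where
  "triple_mult s m (x1, x2, x3) (y1, y2, y3) =
     triple_scale s (1 / 2)
       (m x2 y3 + m y2 x3, m x3 y1 + m y3 x1, m x1 y2 + m y1 x2)"


section \<open>Tensor products of algebras on coordinate spaces\<close>

text \<open>
  The tensor product of \<open>'k ^ 'm\<close> and \<open>'k ^ 'n\<close> is realized on \<open>'k ^ ('m \<times> 'n)\<close>. The universal
  property is \<open>tensor_universal\<close>. The product is the one determined by the products of pure
  tensors, see \<open>tensor_mult_tensor\<close> and \<open>tensor_mult_unique\<close>.
\<close>

definition tensor :: "'k::field ^ 'm::finite \<Rightarrow> 'k ^ 'n::finite \<Rightarrow> 'k ^ ('m \<times> 'n)" where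
  "tensor a b = (\<chi> p. a $ fst p * b $ snd p)"

definition tensor_mult ::
  "('k::field ^ 'm \<Rightarrow> 'k ^ 'm \<Rightarrow> 'k ^ 'm) \<Rightarrow> ('k ^ 'n \<Rightarrow> 'k ^ 'n \<Rightarrow> 'k ^ 'n) \<Rightarrow>
   'k ^ ('m \<times> 'n) \<Rightarrow> 'k ^ ('m \<times> 'n) \<Rightarrow> 'k ^ ('m::finite \<times> 'n::finite)" where
  "tensor_mult m1 m2 x y =
     (\<Sum>p\<in>UNIV. \<Sum>q\<in>UNIV. (x $ p * y $ q) *s
        tensor (m1 (axis (fst p) 1) (axis (fst q) 1)) (m2 (axis (snd p) 1) (axis (snd q) 1)))"

lemma linear_tensor:
  "Vector_Spaces.linear (*s) (*s) (tensor a)"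
  "Vector_Spaces.linear (*s) (*s) (\<lambda>a. tensor a b)"
  by (unfold_locales; simp add: tensor_def vec_eq_iff algebra_simps)+

lemma tensor_axis: "tensor (axis i 1) (axis j 1) = axis (i, j) 1"
  by (auto simp: tensor_def axis_def vec_eq_iff)

lemma linear_expand:
  assumes "Vector_Spaces.linear (*s) s f"
  shows "f (x :: 'k::field ^ 'n::finite) = (\<Sum>i\<in>UNIV. s (x $ i) (f (axis i 1)))"
proof -
  interpret Vector_Spaces.linear "(*s)" s f by (rule assms)
  have "f x = f (\<Sum>i\<in>UNIV. x $ i *s axis i 1)" by (simp add: basis_expansion)
  then show ?thesis by (simp add: sum scale)
qed

lemma bilinear_expand:
  fixes f :: "'k::field ^ 'm::finite \<Rightarrow> 'k ^ 'n::finite \<Rightarrow> 'c::ab_group_add"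
  assumes l1: "\<And>a. Vector_Spaces.linear (*s) s (f a)"
    and l2: "\<And>b. Vector_Spaces.linear (*s) s (\<lambda>a. f a b)"
  shows "f a b = (\<Sum>i\<in>UNIV. \<Sum>j\<in>UNIV. s (a $ i * b $ j) (f (axis i 1) (axis j 1)))"
proof -
  interpret Vector_Spaces.linear "(*s)" s "f a" by (rule l1)
  have "f a b = (\<Sum>i\<in>UNIV. s (a $ i) (f (axis i 1) b))"
    by (rule linear_expand[OF l2])
  also have "\<dots> = (\<Sum>i\<in>UNIV. \<Sum>j\<in>UNIV. s (a $ i * b $ j) (f (axis i 1) (axis j 1)))"
    by (subst linear_expand[OF l1]) (simp add: vs2.scale_sum_right)
  finally show ?thesis .
qed

theorem tensor_universal:
  fixes f :: "'k::field ^ 'm::finite \<Rightarrow> 'k ^ 'n::finite \<Rightarrow> 'c::ab_group_add"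
  assumes l1: "\<And>a. Vector_Spaces.linear (*s) s (f a)"
    and l2: "\<And>b. Vector_Spaces.linear (*s) s (\<lambda>a. f a b)"
  shows "\<exists>!g. Vector_Spaces.linear (*s) s g \<and> (\<forall>a b. g (tensor a b) = f a b)"
proof (rule ex1I)
  interpret Vector_Spaces.linear "(*s)" s "f a" for a by (rule l1)
  let ?g = "\<lambda>x :: 'k ^ ('m \<times> 'n). \<Sum>p\<in>UNIV. s (x $ p) (f (axis (fst p) 1) (axis (snd p) 1))"
  have "Vector_Spaces.linear (*s) s ?g"
    by unfold_locales
      (simp_all add: vs2.scale_left_distrib sum.distrib vs2.scale_sum_right)
  moreover have "?g (tensor a b) = f a b" for a b
  proof -
    have "?g (tensor a b) = (\<Sum>(i, j)\<in>UNIV \<times> UNIV. s (a $ i * b $ j) (f (axis i 1) (axis j 1)))"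
      by (simp add: tensor_def case_prod_unfold)
    also have "\<dots> = f a b"
      by (subst bilinear_expand[OF l1 l2]) (simp add: sum.cartesian_product)
    finally show ?thesis .
  qed
  ultimately show "Vector_Spaces.linear (*s) s ?g \<and> (\<forall>a b. ?g (tensor a b) = f a b)" by blast
  fix g assume g: "Vector_Spaces.linear (*s) s g \<and> (\<forall>a b. g (tensor a b) = f a b)"
  show "g = ?g"
  proof
    fix x
    have "g x = (\<Sum>p\<in>UNIV. s (x $ p) (g (axis p 1)))"
      using g by (intro linear_expand) auto
    moreover have "g (axis p 1) = f (axis (fst p) 1) (axis (snd p) 1)" for p
      using g by (metis tensor_axis prod.collapse)
    ultimately show "g x = ?g x" by simp
  qed
qed

lemma linear_tensor_mult:
  "Vector_Spaces.linear (*s) (*s) (tensor_mult m1 m2 x)"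
  "Vector_Spaces.linear (*s) (*s) (\<lambda>x. tensor_mult m1 m2 x y)"
  by (unfold_locales; simp add: tensor_mult_def distrib_left distrib_right sum.distrib
      vec.scale_left_distrib vec.scale_sum_right mult_ac)+

lemma tensor_mult_unique:
  fixes m1 :: "'k::field ^ 'm::finite \<Rightarrow> 'k ^ 'm \<Rightarrow> 'k ^ 'm"
    and m2 :: "'k ^ 'n::finite \<Rightarrow> 'k ^ 'n \<Rightarrow> 'k ^ 'n"
  assumes "\<And>x. Vector_Spaces.linear (*s) (*s) (m x)"
    and "\<And>y. Vector_Spaces.linear (*s) (*s) (\<lambda>x. m x y)"
    and t: "\<And>a1 a2 b1 b2. m (tensor a1 b1) (tensor a2 b2) = tensor (m1 a1 a2) (m2 b1 b2)"
  shows "m = tensor_mult m1 m2"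
proof (intro ext)
  fix x y
  have "m (axis p 1) (axis q 1)
      = tensor (m1 (axis (fst p) 1) (axis (fst q) 1)) (m2 (axis (snd p) 1) (axis (snd q) 1))" for p q
    using t[of "axis (fst p) 1" "axis (snd p) 1" "axis (fst q) 1" "axis (snd q) 1"]
    by (simp add: tensor_axis)
  then show "m x y = tensor_mult m1 m2 x y"
    unfolding tensor_mult_def by (subst bilinear_expand[OF assms(1,2)]) simp
qed

lemma tensor_mult_tensor:
  fixes m1 :: "'k::field ^ 'm::finite \<Rightarrow> 'k ^ 'm \<Rightarrow> 'k ^ 'm"
    and m2 :: "'k ^ 'n::finite \<Rightarrow> 'k ^ 'n \<Rightarrow> 'k ^ 'n"
  assumes m1: "\<And>a. Vector_Spaces.linear (*s) (*s) (m1 a)"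
      "\<And>b. Vector_Spaces.linear (*s) (*s) (\<lambda>a. m1 a b)"
    and m2: "\<And>a. Vector_Spaces.linear (*s) (*s) (m2 a)"
      "\<And>b. Vector_Spaces.linear (*s) (*s) (\<lambda>a. m2 a b)"
  shows "tensor_mult m1 m2 (tensor a1 b1) (tensor a2 b2) = tensor (m1 a1 a2) (m2 b1 b2)"
proof -
  have "tensor_mult m1 m2 (tensor a1 b1) (tensor a2 b2) $ r = tensor (m1 a1 a2) (m2 b1 b2) $ r" for r
  proof -
    let ?M = "\<lambda>i k. a1 $ i * a2 $ k * m1 (axis i 1) (axis k 1) $ fst r"
    let ?N = "\<lambda>j l. b1 $ j * b2 $ l * m2 (axis j 1) (axis l 1) $ snd r"
    have "tensor_mult m1 m2 (tensor a1 b1) (tensor a2 b2) $ r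
        = (\<Sum>(i, j)\<in>UNIV \<times> UNIV. \<Sum>(k, l)\<in>UNIV \<times> UNIV. ?M i k * ?N j l)"
      by (simp add: tensor_mult_def tensor_def case_prod_unfold mult_ac)
    also have "\<dots> = (\<Sum>i\<in>UNIV. \<Sum>j\<in>UNIV. \<Sum>k\<in>UNIV. \<Sum>l\<in>UNIV. ?M i k * ?N j l)"
      by (simp only: sum.cartesian_product[symmetric])
    also have "\<dots> = (\<Sum>i\<in>UNIV. \<Sum>k\<in>UNIV. \<Sum>j\<in>UNIV. \<Sum>l\<in>UNIV. ?M i k * ?N j l)"
      by (intro sum.cong refl) (rule sum.swap)
    also have "\<dots> = (\<Sum>i\<in>UNIV. \<Sum>k\<in>UNIV. ?M i k) * (\<Sum>j\<in>UNIV. \<Sum>l\<in>UNIV. ?N j l)"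
      by (simp only: sum_distrib_left[symmetric] sum_distrib_right[symmetric])
    also have "(\<Sum>i\<in>UNIV. \<Sum>k\<in>UNIV. ?M i k) = m1 a1 a2 $ fst r"
      by (subst bilinear_expand[OF m1]) simp
    also have "(\<Sum>j\<in>UNIV. \<Sum>l\<in>UNIV. ?N j l) = m2 b1 b2 $ snd r"
      by (subst bilinear_expand[OF m2]) simp
    also have "m1 a1 a2 $ fst r * m2 b1 b2 $ snd r = tensor (m1 a1 a2) (m2 b1 b2) $ r"
      by (simp add: tensor_def)
    finally show ?thesis .
  qed
  then show ?thesis by (simp add: vec_eq_iff)
qed

end

theory Submission
  imports Defs
begin

text \<open>
  In the triple of a commutative algebra, multiplication by \<open>x = (x1, x2, x3)\<close> is half of the
  symmetric block matrix with zero diagonal whose off-diagonal blocks are multiplications by the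
  \<open>xi\<close>. So its trace vanishes, and the Killing form is half the orthogonal sum of three copies of
  the Killing form of the factor (\<open>killing_form_triple\<close>); nondegeneracy and invariance are inherited.
  Simplicity is inherited too: multiplying twice by elements of single summands isolates a component
  of an element of an ideal, and what is isolated spreads to all three summands
  (\<open>simple_triple\<close>).

  For the simplicial algebra with \<open>c = - 1 / (n - 1)\<close>, everything rests on the identity
  \<open>\<gamma> \<circ> x = \<tau>(\<gamma>, x) \<gamma> + c x\<close> for each basis generator \<open>\<gamma>\<close> (\<open>simplicial_mult_gen_left\<close>), in which
  \<open>\<tau>\<close> is an explicit symmetric form that turns out to be the Killing form. An ideal
  containing \<open>x\<close> therefore contains \<open>\<tau>(\<gamma>, x) \<gamma>\<close>, and since \<open>\<tau>\<close> is nondegenerate, a nonzero ideal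
  contains a generator, hence all of them.

  The same identity rules out an isomorphism from the triple to a simplicial algebra: it says that,
  up to multiples of \<open>\<gamma>\<close>, multiplication by \<open>\<gamma>\<close> is a nonzero scalar. In a triple, multiplication by
  any \<open>e\<close> sends the first summand into the sum of the other two, so the first summand
  would lie on the line of the first component of \<open>e\<close>, although its dimension is at least \<open>2\<close>
  (\<open>triple_not_isomorphic_simplicial\<close>).

  Finally, the triple is the tensor product with the triple of the ground field, and the latter is
  the simplicial algebra of the tetrahedron: its three coordinate vectors are the midpoints of the
  three edges at one vertex (\<open>triple_isomorphic_tensor\<close>).
\<close>


section \<open>Traces\<close>

context fd_vector_space
begin

lemma endo_trace_add: "endo_trace (\<lambda>v. f v + g v) = endo_trace f + endo_trace g"
  by (simp add: endo_trace_def representation_add independent_extend_basis independent_empty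
      sum.distrib)

lemma endo_trace_scale: "endo_trace (\<lambda>v. scale c (f v)) = c * endo_trace f"
  by (simp add: endo_trace_def representation_scale independent_extend_basis independent_empty
      sum_distrib_left)

lemma endo_trace_zero: "endo_trace (\<lambda>v. 0) = 0"
  by (simp add: endo_trace_def representation_zero)

text \<open>
  The trace is computed by any decomposition of the identity as a sum of the rank one maps
  \<open>v \<mapsto> \<phi> i v * e i\<close>. As the \<open>e i\<close> are given as a family and need no independence, this applies to
  indexed families without turning them into basis sets first.
\<close>

lemma endo_trace_frame:
  assumes f: "Vector_Spaces.linear scale scale f"
    and \<phi>: "\<And>i. i \<in> I \<Longrightarrow> Vector_Spaces.linear scale (*) (\<phi> i)"
    and frame: "\<And>v. (\<Sum>i\<in>I. scale (\<phi> i v) (e i)) = v"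
  shows "endo_trace f = (\<Sum>i\<in>I. \<phi> i (f (e i)))"
proof -
  interpret f: Vector_Spaces.linear scale scale f by (rule f)
  define B where "B = extend_basis {}"
  have B: "independent B" "span B = UNIV"
    by (simp_all add: B_def independent_extend_basis independent_empty)
  have "finite B" using B by (auto intro: independent_finite)
  have expB: "(\<Sum>b\<in>B. scale (representation B v b) b) = v" for v
    using B \<open>finite B\<close> by (intro sum_representation_eq) auto
  have col: "representation B (f b) b = (\<Sum>i\<in>I. \<phi> i b * representation B (f (e i)) b)" for b
  proof -
    have "f b = (\<Sum>i\<in>I. scale (\<phi> i b) (f (e i)))"
      by (subst frame[of b, symmetric]) (simp only: f.sum f.scale)
    then show ?thesis
      using B by (simp add: representation_sum representation_scale)
  qed
  have row: "(\<Sum>b\<in>B. \<phi> i b * representation B (f (e i)) b) = \<phi> i (f (e i))" if "i \<in> I" for i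
  proof -
    interpret \<phi>: Vector_Spaces.linear scale "(*)" "\<phi> i" by (rule \<phi>[OF that])
    have "\<phi> i (f (e i)) = \<phi> i (\<Sum>b\<in>B. scale (representation B (f (e i)) b) b)"
      by (simp add: expB)
    then show ?thesis by (simp only: \<phi>.sum \<phi>.scale mult.commute)
  qed
  have "endo_trace f = (\<Sum>b\<in>B. \<Sum>i\<in>I. \<phi> i b * representation B (f (e i)) b)"
    unfolding endo_trace_def B_def[symmetric] by (simp only: col)
  also have "\<dots> = (\<Sum>i\<in>I. \<phi> i (f (e i)))"
    by (subst sum.swap) (simp add: row)
  finally show ?thesis .
qed

lemma vector_space_triple: "vector_space (triple_scale scale)"
  by unfold_locales (auto simp: scale_right_distrib scale_left_distrib)

text \<open>
  The decomposition of the identity of the triple, from which both its finite dimension and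
  its trace are read off.
\<close>

lemma triple_frame:
  defines "B \<equiv> extend_basis {}"
  shows "(\<Sum>b\<in>B. triple_scale scale (representation B (fst v) b) (b, 0, 0))
    + (\<Sum>b\<in>B. triple_scale scale (representation B (fst (snd v)) b) (0, b, 0))
    + (\<Sum>b\<in>B. triple_scale scale (representation B (snd (snd v)) b) (0, 0, b)) = v"
proof -
  have B: "independent B" "span B = UNIV"
    by (simp_all add: B_def independent_extend_basis independent_empty)
  have "finite B" using B by (auto intro: independent_finite)
  have expB: "(\<Sum>b\<in>B. scale (representation B v b) b) = v" for v
    using B \<open>finite B\<close> by (intro sum_representation_eq) auto
  show ?thesis
    by (cases v) (simp add: prod_eq_iff fst_sum snd_sum expB)
qed

lemma fd_vector_space_triple: "fd_vector_space (triple_scale scale)"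
proof -
  interpret T: vector_space "triple_scale scale" by (rule vector_space_triple)
  define B where "B = extend_basis {}"
  have "finite B"
    by (simp add: B_def independent_extend_basis independent_empty independent_finite)
  let ?C = "(\<lambda>b. (b, 0, 0)) ` B \<union> (\<lambda>b. (0, b, 0)) ` B \<union> (\<lambda>b. (0, 0, b)) ` B"
  have "v \<in> T.span ?C" for v
    by (subst triple_frame[of v, symmetric], fold B_def)
      (intro T.span_add T.span_sum T.span_scale T.span_base; auto)
  then have "T.span ?C = UNIV" by blast
  moreover have "finite ?C" using \<open>finite B\<close> by simp
  ultimately show ?thesis
    by (intro fd_vector_space.intro fd_vector_space_axioms.intro T.vector_space_axioms exI[of _ ?C])
      simp
qed

lemma endo_trace_triple:
  assumes F: "Vector_Spaces.linear (triple_scale scale) (triple_scale scale) F"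
  shows "fd_vector_space.endo_trace (triple_scale scale) F
    = endo_trace (\<lambda>v. fst (F (v, 0, 0))) + endo_trace (\<lambda>v. fst (snd (F (0, v, 0))))
      + endo_trace (\<lambda>v. snd (snd (F (0, 0, v))))"
proof -
  interpret T: fd_vector_space "triple_scale scale" by (rule fd_vector_space_triple)
  define B where "B = extend_basis {}"
  have B: "independent B" "span B = UNIV"
    by (simp_all add: B_def independent_extend_basis independent_empty)
  have fin: "finite B" using B by (auto intro: independent_finite)
  define \<phi> where "\<phi> = case_sum (\<lambda>b v. representation B (fst v) b)
     (case_sum (\<lambda>b v. representation B (fst (snd v)) b) (\<lambda>b v. representation B (snd (snd v)) b))"
  define e :: "'a + 'a + 'a \<Rightarrow> 'a \<times> 'a \<times> 'a"
    where "e = case_sum (\<lambda>b. (b, 0, 0)) (case_sum (\<lambda>b. (0, b, 0)) (\<lambda>b. (0, 0, b)))"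
  have lin: "Vector_Spaces.linear (triple_scale scale) (*) (\<phi> i)" for i
  proof -
    have proj: "Vector_Spaces.linear (triple_scale scale) (*) (\<lambda>v. representation B (fst v) b)"
      "Vector_Spaces.linear (triple_scale scale) (*) (\<lambda>v. representation B (fst (snd v)) b)"
      "Vector_Spaces.linear (triple_scale scale) (*) (\<lambda>v. representation B (snd (snd v)) b)" for b
      using B by (unfold_locales; auto simp: representation_add representation_scale
          distrib_left distrib_right mult.assoc)+
    consider (1) b where "i = Inl b" | (2) b where "i = Inr (Inl b)" | (3) b where "i = Inr (Inr b)"
      by (metis sum.exhaust)
    then show ?thesis
      by cases (simp_all only: \<phi>_def sum.case proj)
  qed
  have "T.endo_trace F = (\<Sum>i\<in>B <+> B <+> B. \<phi> i (F (e i)))"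
  proof (rule T.endo_trace_frame[OF F lin])
    show "(\<Sum>i\<in>B <+> B <+> B. triple_scale scale (\<phi> i v) (e i)) = v" for v
      using triple_frame[of v] fin
      by (simp add: sum.Plus \<phi>_def e_def B_def[symmetric] add.assoc del: triple_scale.simps)
  qed
  then show ?thesis
    using fin by (simp add: sum.Plus \<phi>_def e_def endo_trace_def B_def add.assoc)
qed

end

lemma fd_vector_space_vec: "fd_vector_space ((*s) :: 'k::field \<Rightarrow> 'k ^ 'n::finite \<Rightarrow> 'k ^ 'n)"
  using commutative_algebra_simplicial[where 'a='k and 'b='n]
  by (simp add: commutative_algebra_def fd_algebra_def)

lemma endo_trace_vec:
  fixes f :: "'k::field ^ 'n::finite \<Rightarrow> 'k ^ 'n"
  assumes "Vector_Spaces.linear (*s) (*s) f"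
  shows "fd_vector_space.endo_trace (*s) f = (\<Sum>i\<in>UNIV. f (axis i 1) $ i)"
proof (rule fd_vector_space.endo_trace_frame[OF fd_vector_space_vec assms])
  show "Vector_Spaces.linear (*s) (*) (\<lambda>v :: 'k ^ 'n. v $ i)" for i
    by unfold_locales (simp_all add: algebra_simps)
  show "(\<Sum>i\<in>UNIV. v $ i *s axis i 1) = v" for v :: "'k ^ 'n"
    by (rule basis_expansion)
qed


section \<open>The multiplication of a simplicial algebra\<close>

text \<open>
  For \<open>c = - 1 / (n - 1)\<close> this is the Killing form of the simplicial algebra, see
  \<open>killing_form_simplicial\<close>. The coefficient is a parameter, tied to the dimension in the lemmas by
  \<open>c * (n - 1) = - 1\<close>, which both avoids division and forces \<open>n \<noteq> 1\<close> in the field.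
\<close>

definition simplicial_form :: "'k::field \<Rightarrow> 'k ^ 'n \<Rightarrow> 'k ^ 'n::finite \<Rightarrow> 'k" where
  "simplicial_form c x y =
     (1 - 2 * c) * (\<Sum>i\<in>UNIV. x $ i * y $ i) + c * ((\<Sum>i\<in>UNIV. x $ i) * (\<Sum>i\<in>UNIV. y $ i))"

lemma simplicial_form_commute: "simplicial_form c x y = simplicial_form c y x"
  by (simp add: simplicial_form_def mult.commute)

lemma sum_axis: "(\<Sum>j\<in>UNIV. axis i (1 :: 'k::field) $ j * f j) = f (i :: 'n::finite)"
  by (simp add: axis_def if_distrib[of "\<lambda>a. a * _"] cong: if_cong)

lemma sum_axis_one: "(\<Sum>j\<in>UNIV. axis (i :: 'n::finite) (1 :: 'k::field) $ j) = 1"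
  using sum_axis[of i "\<lambda>_. 1 :: 'k"] by simp

lemma simplicial_form_axis:
  "simplicial_form c (axis i 1) x = (1 - 2 * c) * x $ i + c * (\<Sum>j\<in>UNIV. x $ j)"
  by (simp add: simplicial_form_def sum_axis sum_axis_one)

lemma simplicial_mult_nth:
  fixes x y :: "'k::field ^ 'n::finite"
  assumes c: "c * (of_nat CARD('n) - 1) = - 1"
  shows "simplicial_mult x y $ k
    = (1 - 2 * c) * (x $ k * y $ k) + c * (x $ k * (\<Sum>j\<in>UNIV. y $ j) + y $ k * (\<Sum>i\<in>UNIV. x $ i))"
proof -
  have "of_nat CARD('n) - 1 \<noteq> (0 :: 'k)" using c by auto
  then have c': "- 1 / (of_nat CARD('n) - 1) = c"
    using c by (simp add: field_simps)
  \<comment> \<open>The off-diagonal formula is used for all pairs; on the diagonal it gives \<open>2 * c\<close> in place of \<open>1\<close>,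
    which accounts for the coefficient \<open>1 - 2 * c\<close>.\<close>
  have "simplicial_mult x y $ k = (\<Sum>i\<in>UNIV. \<Sum>j\<in>UNIV.
      (if i = j then axis k 1 $ i * ((1 - 2 * c) * (x $ i * y $ j)) else 0)
      + c * (axis k 1 $ i * x $ i * y $ j) + c * (x $ i * (axis k 1 $ j * y $ j)))"
    unfolding simplicial_mult_def c'
    by (auto simp: simplex_gen_def axis_def algebra_simps intro!: sum.cong)
  also have "\<dots> = (\<Sum>i\<in>UNIV. axis k 1 $ i * ((1 - 2 * c) * (x $ i * y $ i)))
      + c * ((\<Sum>i\<in>UNIV. axis k 1 $ i * x $ i) * (\<Sum>j\<in>UNIV. y $ j))
      + c * ((\<Sum>i\<in>UNIV. x $ i) * (\<Sum>j\<in>UNIV. axis k 1 $ j * y $ j))"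
    by (simp only: sum.distrib sum.delta' finite UNIV_I if_True
        flip: sum_distrib_left sum_distrib_right)
  also have "\<dots> = (1 - 2 * c) * (x $ k * y $ k)
      + c * (x $ k * (\<Sum>j\<in>UNIV. y $ j) + y $ k * (\<Sum>i\<in>UNIV. x $ i))"
    by (simp only: sum_axis) (simp add: algebra_simps)
  finally show ?thesis .
qed

text \<open>
  Multiplication by a generator is the scalar \<open>c\<close> plus a map of rank one whose image is spanned by
  the generator. This is the reason for simplicity, for the value of the Killing form, and for the
  obstruction to being a triple.
\<close>

lemma simplicial_mult_gen_left:
  fixes x :: "'k::field ^ 'n::finite"
  assumes c: "c * (of_nat CARD('n) - 1) = - 1"
  shows "simplicial_mult (axis i 1) x = simplicial_form c (axis i 1) x *s axis i 1 + c *s x"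
  by (simp add: vec_eq_iff simplicial_mult_nth[OF c] simplicial_form_axis sum_axis_one)
    (simp add: axis_def algebra_simps)


section \<open>The triple of a commutative algebra\<close>

locale commutative_algebra_char_not_2 = commutative_algebra scale mult
  for scale :: "'k::field \<Rightarrow> 'a::ab_group_add \<Rightarrow> 'a" and mult +
  assumes two_nonzero: "(2 :: 'k) \<noteq> 0"
begin

sublocale left: Vector_Spaces.linear scale scale "mult x" for x
  by (rule linear_mult_left)

sublocale right: Vector_Spaces.linear scale scale "\<lambda>x. mult x y" for y
  by (rule linear_mult_right)

abbreviation "S \<equiv> triple_scale scale"
abbreviation "T \<equiv> triple_mult scale mult"

text \<open>
  With the factors in this order, multiplication by \<open>x\<close> is visibly a symmetric block matrix of
  multiplications by its components.
\<close>

lemma triple_mult_eq: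
  "T (x1, x2, x3) (y1, y2, y3) =
    (scale (1 / 2) (mult x2 y3 + mult x3 y2),
     scale (1 / 2) (mult x3 y1 + mult x1 y3),
     scale (1 / 2) (mult x1 y2 + mult x2 y1))"
  by (simp add: mult_commute[of y1] mult_commute[of y2] mult_commute[of y3])

lemma commutative_algebra_triple: "commutative_algebra S T"
proof -
  interpret V: fd_vector_space S by (rule fd_vector_space_triple)
  show ?thesis
  proof unfold_locales
    fix x y z :: "'a \<times> 'a \<times> 'a" and c :: 'k
    obtain x1 x2 x3 y1 y2 y3 z1 z2 z3
      where xyz: "x = (x1, x2, x3)" "y = (y1, y2, y3)" "z = (z1, z2, z3)"
      by (metis prod.exhaust)
    show "T x y = T y x"
      by (simp add: xyz add.commute)
    show "T x (y + z) = T x y + T x z" "T (x + y) z = T x z + T y z"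
      by (simp_all add: xyz triple_mult_eq left.add right.add scale_right_distrib
          del: triple_mult.simps)
    show "T x (S c y) = S c (T x y)" "T (S c x) y = S c (T x y)"
      by (simp_all add: xyz triple_mult_eq left.scale right.scale scale_right_distrib
          scale_left_commute del: triple_mult.simps)
  qed
qed

text \<open>All diagonal blocks of a multiplication of the triple vanish.\<close>

lemma exact_triple: "exact_commutative_algebra S T"
proof -
  interpret triple: commutative_algebra S T by (rule commutative_algebra_triple)
  show ?thesis
  proof unfold_locales
    show "triple.endo_trace (T x) = 0" for x
      by (cases x) (simp add: endo_trace_triple[OF triple.linear_mult_left] left.zero right.zero
          endo_trace_zero)
  qed
qed

lemma killing_form_zero_right: "killing_form x 0 = 0"
  by (simp add: killing_form_def comp_def left.zero right.zero endo_trace_zero)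

lemma killing_form_add_left: "killing_form (x + y) z = killing_form x z + killing_form y z"
  by (simp add: killing_form_def comp_def right.add endo_trace_add)

lemma killing_form_add_right: "killing_form z (x + y) = killing_form z x + killing_form z y"
  by (simp add: killing_form_def comp_def left.add right.add endo_trace_add)

lemma killing_form_scale_left: "killing_form (scale c x) y = c * killing_form x y"
  by (simp add: killing_form_def comp_def right.scale endo_trace_scale)

lemma killing_form_scale_right: "killing_form x (scale c y) = c * killing_form x y"
  by (simp add: killing_form_def comp_def left.scale right.scale endo_trace_scale)

text \<open>
  Each \<open>L(xi) L(yi)\<close> occurs in two of the three diagonal blocks of the product, with the factor
  \<open>1 / 4\<close>, and no mixed term \<open>L(xi) L(yj)\<close> occurs there.
\<close>

lemma killing_form_triple:
  "fd_algebra.killing_form S T (x1, x2, x3) (y1, y2, y3)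
    = 1 / 2 * (killing_form x1 y1 + killing_form x2 y2 + killing_form x3 y3)"
proof -
  interpret triple: commutative_algebra S T by (rule commutative_algebra_triple)
  have block: "endo_trace (\<lambda>v. scale (1 / 2) (mult a (scale (1 / 2) (mult b v))
        + mult c (scale (1 / 2) (mult d v))))
      = 1 / 2 * (1 / 2) * (killing_form a b + killing_form c d)" for a b c d
    by (simp only: left.scale endo_trace_scale endo_trace_add killing_form_def comp_def
        distrib_left mult.assoc)
  have lin: "Vector_Spaces.linear S S (T (x1, x2, x3) \<circ> T (y1, y2, y3))"
    by (rule Vector_Spaces.linear_compose[OF triple.linear_mult_left triple.linear_mult_left])
  have "1 / 2 + 1 / 2 = (1 :: 'k)"
    using two_nonzero by (simp flip: add_divide_distrib)
  then have half: "1 / 2 * (1 / 2 * a) + 1 / 2 * (1 / 2 * a) = (1 / 2 * a :: 'k)" for a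
    by (metis distrib_left distrib_right mult_1_left)
  have "triple.killing_form (x1, x2, x3) (y1, y2, y3)
      = 1 / 2 * (1 / 2) * (killing_form x2 y2 + killing_form x3 y3)
        + 1 / 2 * (1 / 2) * (killing_form x3 y3 + killing_form x1 y1)
        + 1 / 2 * (1 / 2) * (killing_form x1 y1 + killing_form x2 y2)"
    unfolding triple.killing_form_def endo_trace_triple[OF lin]
    by (simp only: comp_def triple_mult_eq fst_conv snd_conv left.zero add_0_left add_0_right
        flip: block)
  also have "\<dots> = (1 / 2 * (1 / 2 * killing_form x1 y1) + 1 / 2 * (1 / 2 * killing_form x1 y1))
      + (1 / 2 * (1 / 2 * killing_form x2 y2) + 1 / 2 * (1 / 2 * killing_form x2 y2))
      + (1 / 2 * (1 / 2 * killing_form x3 y3) + 1 / 2 * (1 / 2 * killing_form x3 y3))"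
    by (simp only: distrib_left mult.assoc add_ac)
  also have "\<dots> = 1 / 2 * (killing_form x1 y1 + killing_form x2 y2 + killing_form x3 y3)"
    unfolding half by (simp only: distrib_left)
  finally show ?thesis .
qed

text \<open>
  After moving all products to the second argument, both sides of the invariance are the same sum of
  the six terms \<open>\<tau>(xi, yj \<circ> zk)\<close> with distinct \<open>i\<close>, \<open>j\<close>, \<open>k\<close>.
\<close>

lemma killing_metrized_triple:
  assumes "killing_metrized_algebra scale mult"
  shows "killing_metrized_algebra S T"
proof -
  interpret K: killing_metrized_algebra scale mult by (rule assms)
  interpret triple: commutative_algebra S T by (rule commutative_algebra_triple)
  show ?thesis
  proof unfold_locales
    fix x :: "'a \<times> 'a \<times> 'a"
    assume x: "\<And>y. triple.killing_form x y = 0"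
    obtain x1 x2 x3 where [simp]: "x = (x1, x2, x3)" by (metis prod.exhaust)
    have "killing_form x1 y = 0 \<and> killing_form x2 y = 0 \<and> killing_form x3 y = 0" for y
      using x[of "(y, 0, 0)"] x[of "(0, y, 0)"] x[of "(0, 0, y)"] two_nonzero
      by (simp add: killing_form_triple killing_form_zero_right)
    then show "x = 0"
      using K.killing_nondegenerate by (auto simp: zero_prod_def)
  next
    fix x y z :: "'a \<times> 'a \<times> 'a"
    obtain x1 x2 x3 y1 y2 y3 z1 z2 z3
      where xyz: "x = (x1, x2, x3)" "y = (y1, y2, y3)" "z = (z1, z2, z3)"
      by (metis prod.exhaust)
    have inv: "killing_form (mult a b) c = killing_form a (mult b c)" for a b c
      by (rule K.killing_invariant)
    show "triple.killing_form (T x y) z = triple.killing_form x (T y z)"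
      by (simp only: xyz triple_mult_eq killing_form_triple killing_form_add_left
          killing_form_add_right killing_form_scale_left killing_form_scale_right
          inv distrib_left add_ac)
  qed
qed

text \<open>
  For an ideal \<open>I\<close>, the elements all of whose three embeddings lie in \<open>I\<close> form an ideal \<open>K\<close> of the
  factor. If \<open>K\<close> is everything, so is \<open>I\<close>. If \<open>K\<close> is zero, then two multiplications by
  elements of single summands isolate each component of an element of \<open>I\<close>, and two further ones bring
  the result into \<open>K\<close>; as nothing nonzero in a simple commutative algebra is annihilated
  by all multiplications, the components vanish.
\<close>

lemma simple_triple:
  assumes "simple_algebra scale mult"
  shows "simple_algebra S T"
proof -
  interpret A: simple_algebra scale mult by (rule assms)
  interpret triple: commutative_algebra S T by (rule commutative_algebra_triple)
  have twice: "scale (1 / 2) (scale 2 x) = x" for x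
    using two_nonzero by simp
  \<comment> \<open>The annihilator is an ideal, and a proper one since the product is not zero.\<close>
  have "ideal {x. \<forall>a. mult a x = 0}"
    unfolding ideal_def subspace_def
    by (auto simp: left.zero right.zero left.add left.scale) (metis mult_commute left.zero)
  moreover have "{x. \<forall>a. mult a x = 0} \<noteq> UNIV"
    using A.mult_nonzero by blast
  ultimately have "{x. \<forall>a. mult a x = 0} = {0}"
    using A.ideal_trivial by blast
  then have "x = 0" if "\<And>a. mult a x = 0" for x
    using that by auto
  then have faithful: "x = 0" if "\<And>a b. mult b (mult a x) = 0" for x
    using that by simp
  show ?thesis
  proof unfold_locales
    obtain x y where "mult x y \<noteq> 0" using A.mult_nonzero by blast
    then have "T (x, 0, 0) (0, scale 2 y, 0) \<noteq> 0"
      by (simp add: triple_mult_eq left.zero right.zero left.scale two_nonzero prod_eq_iff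
          del: triple_mult.simps)
    then show "\<exists>x y. T x y \<noteq> 0" by blast
  next
    fix I assume I: "triple.ideal I"
    have add: "v + w \<in> I" if "v \<in> I" "w \<in> I" for v w
      using I that unfolding triple.ideal_def triple.subspace_def by blast
    have scl: "S c v \<in> I" if "v \<in> I" for v c
      using I that unfolding triple.ideal_def triple.subspace_def by blast
    have zero: "0 \<in> I"
      using I unfolding triple.ideal_def triple.subspace_def by blast
    have mul: "T a v \<in> I" if "v \<in> I" for a v
      using I that unfolding triple.ideal_def by blast
    \<comment> \<open>Multiplying by an element of another summand moves to the third one; doubling it cancels
      the factor \<open>1 / 2\<close> in the product.\<close>
    have move:
      "(u, 0, 0) \<in> I \<Longrightarrow> (0, mult a u, 0) \<in> I" "(u, 0, 0) \<in> I \<Longrightarrow> (0, 0, mult a u) \<in> I"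
      "(0, u, 0) \<in> I \<Longrightarrow> (mult a u, 0, 0) \<in> I" "(0, u, 0) \<in> I \<Longrightarrow> (0, 0, mult a u) \<in> I"
      "(0, 0, u) \<in> I \<Longrightarrow> (mult a u, 0, 0) \<in> I" "(0, 0, u) \<in> I \<Longrightarrow> (0, mult a u, 0) \<in> I"
      for u a
      using mul[of "(u, 0, 0)" "(0, 0, scale 2 a)"] mul[of "(u, 0, 0)" "(0, scale 2 a, 0)"]
        mul[of "(0, u, 0)" "(0, 0, scale 2 a)"] mul[of "(0, u, 0)" "(scale 2 a, 0, 0)"]
        mul[of "(0, 0, u)" "(0, scale 2 a, 0)"] mul[of "(0, 0, u)" "(scale 2 a, 0, 0)"]
      by (simp_all add: triple_mult_eq left.zero right.zero right.scale twice
          del: triple_mult.simps scale_scale)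
    define K where "K = {u. (u, 0, 0) \<in> I \<and> (0, u, 0) \<in> I \<and> (0, 0, u) \<in> I}"
    have "ideal K"
      unfolding ideal_def subspace_def
    proof (intro conjI allI ballI)
      show "0 \<in> K" using zero by (simp add: K_def zero_prod_def)
      show "x + y \<in> K" if "x \<in> K" "y \<in> K" for x y
        using that add[of "(x, 0, 0)" "(y, 0, 0)"] add[of "(0, x, 0)" "(0, y, 0)"]
          add[of "(0, 0, x)" "(0, 0, y)"] by (simp add: K_def)
      show "scale c x \<in> K" if "x \<in> K" for x c
        using that scl[of "(x, 0, 0)" c] scl[of "(0, x, 0)" c] scl[of "(0, 0, x)" c]
        by (simp add: K_def)
      show "mult a x \<in> K" if "x \<in> K" for a x
        using that unfolding K_def by (blast intro: move)
      then show "mult x a \<in> K" if "x \<in> K" for a x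
        using that by (simp add: mult_commute[of x])
    qed
    then consider "K = {0}" | "K = UNIV" using A.ideal_trivial by blast
    then show "I = {0} \<or> I = UNIV"
    proof cases
      case 1
      have single: "u = 0" if u: "(u, 0, 0) \<in> I \<or> (0, u, 0) \<in> I \<or> (0, 0, u) \<in> I" for u
      proof -
        have "mult b (mult a u) \<in> K" for a b
          using u unfolding K_def by (blast intro: move)
        then have "mult b (mult a u) = 0" for a b using 1 by blast
        then show ?thesis by (rule faithful)
      qed
      have "v = 0" if v: "v \<in> I" for v
      proof -
        obtain x1 x2 x3 where [simp]: "v = (x1, x2, x3)" by (metis prod.exhaust)
        have "(mult b (mult a x2), 0, 0) \<in> I" "(0, mult b (mult a x3), 0) \<in> I"
          "(0, 0, mult b (mult a x1)) \<in> I" for a b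
          using mul[OF mul[OF v, of "(scale 2 a, 0, 0)"], of "(0, scale 2 b, 0)"]
            mul[OF mul[OF v, of "(0, scale 2 a, 0)"], of "(0, 0, scale 2 b)"]
            mul[OF mul[OF v, of "(0, 0, scale 2 a)"], of "(scale 2 b, 0, 0)"]
          by (simp_all add: triple_mult_eq left.zero right.zero right.scale twice
            del: triple_mult.simps scale_scale)
        then have "mult b (mult a x1) = 0" "mult b (mult a x2) = 0" "mult b (mult a x3) = 0" for a b
          using single by blast+
        then have "x1 = 0" "x2 = 0" "x3 = 0" by (auto intro: faithful)
        then show ?thesis by (simp add: zero_prod_def)
      qed
      then show ?thesis using zero by blast
    next
      case 2
      have "(x1, x2, x3) \<in> I" for x1 x2 x3
      proof -
        have "(x1, 0, 0) \<in> I" "(0, x2, 0) \<in> I" "(0, 0, x3) \<in> I"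
          using 2 unfolding K_def by blast+
        then have "(x1, 0, 0) + ((0, x2, 0) + (0, 0, x3)) \<in> I" by (intro add)
        then show ?thesis by simp
      qed
      then show ?thesis by auto
    qed
  qed
qed

text \<open>
  If \<open>e\<close> corresponds to a generator, then \<open>e \<odot> v\<close> is \<open>c v\<close> up to a multiple of \<open>e\<close>. For \<open>v\<close> in the first
  summand, \<open>e \<odot> v\<close> has no component there, so the first component of \<open>e\<close> would span the factor.
\<close>

lemma triple_not_isomorphic_simplicial:
  fixes c :: 'k
  assumes c: "c * (of_nat CARD('m) - 1) = - 1"
    and dim: "\<And>e. span {e} \<noteq> UNIV"
  shows "\<not> algebra_isomorphic S T (*s) (simplicial_mult :: 'k ^ 'm::finite \<Rightarrow> _)"
proof
  assume "algebra_isomorphic S T (*s) (simplicial_mult :: 'k ^ 'm \<Rightarrow> _)"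
  then obtain f :: "_ \<Rightarrow> 'k ^ 'm" where f: "Vector_Spaces.linear S (*s) f" "bij f"
    and hom: "\<And>x y. f (T x y) = simplicial_mult (f x) (f y)"
    unfolding algebra_isomorphic_def by blast
  interpret f: Vector_Spaces.linear S "(*s)" f by (rule f)
  fix p :: 'm
  obtain e where e: "f e = axis p 1" using f(2) by (metis bij_pointE)
  obtain e1 e2 e3 where [simp]: "e = (e1, e2, e3)" by (metis prod.exhaust)
  have "c \<noteq> 0" using c by auto
  have "y \<in> span {e1}" for y
  proof -
    define t where "t = simplicial_form c (axis p 1) (f (y, 0, 0))"
    have "f (T e (y, 0, 0)) = f (S t e + S c (y, 0, 0))"
      by (simp only: hom e simplicial_mult_gen_left[OF c] f.add f.scale t_def)
    then have "T e (y, 0, 0) = S t e + S c (y, 0, 0)"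
      using f(2) by (meson bij_def injD)
    then have "scale t e1 + scale c y = 0"
      by (simp add: triple_mult_eq left.zero del: triple_mult.simps)
    then have "scale c y = scale (- t) e1"
      by (simp add: eq_neg_iff_add_eq_0 add.commute)
    then have "scale (1 / c) (scale c y) \<in> span {e1}"
      by (simp only: span_scale span_base insertI1)
    then show ?thesis using \<open>c \<noteq> 0\<close> by simp
  qed
  then show False using dim[of e1] by blast
qed

end


section \<open>The simplicial algebra\<close>

text \<open>
  By \<open>simplicial_mult_gen_left\<close> the diagonal entries of \<open>L(x) L(y)\<close> are explicit. Their sum is again a
  combination of the sum of the \<open>xi yi\<close> and the product of the coordinate sums, and the relation
  between \<open>c\<close> and \<open>n\<close> reduces the coefficients to those of \<open>simplicial_form\<close>.
\<close>

lemma killing_form_simplicial: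
  assumes c: "c * (of_nat CARD('n) - 1) = - 1"
  shows "fd_algebra.killing_form (*s) simplicial_mult x (y :: 'k::field ^ 'n::finite)
    = simplicial_form c x y"
proof -
  interpret E: commutative_algebra "(*s)" "simplicial_mult :: 'k ^ 'n \<Rightarrow> _"
    by (rule commutative_algebra_simplicial)
  define a where "a = 1 - 2 * c"
  let ?X = "\<Sum>i\<in>UNIV. x $ i" and ?Y = "\<Sum>i\<in>UNIV. y $ i" and ?P = "\<Sum>i\<in>UNIV. x $ i * y $ i"
  have lin: "Vector_Spaces.linear (*s) (*s) (simplicial_mult x \<circ> simplicial_mult y)"
    by (rule Vector_Spaces.linear_compose[OF linear_simplicial_mult(1) linear_simplicial_mult(1)])
  have "simplicial_mult x (simplicial_mult y (axis i 1)) $ i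
      = a * a * (x $ i * y $ i) + (a * c * ?X) * y $ i + (a * c * ?Y) * x $ i + c * c * ?X * ?Y
        + (a * c) * (x $ i * y $ i) + (c * c * ?Y) * x $ i
        + c * simplicial_mult x y $ i" for i
  proof -
    have "simplicial_mult x (simplicial_mult y (axis i 1))
        = simplicial_form c (axis i 1) y *s simplicial_mult (axis i 1) x + c *s simplicial_mult x y"
      by (simp add: simplicial_mult_commute[of _ "axis i 1"] simplicial_mult_gen_left[OF c]
          simplicial_mult_add_right simplicial_mult_scale_right)
    also have "\<dots> $ i = simplicial_form c (axis i 1) y * (simplicial_form c (axis i 1) x + c * x $ i)
        + c * simplicial_mult x y $ i"
      by (simp add: simplicial_mult_gen_left[OF c] distrib_left mult.assoc)
    finally show ?thesis
      unfolding simplicial_form_axis a_def[symmetric] by (simp add: algebra_simps)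
  qed
  then have "E.killing_form x y = a * a * ?P + a * c * ?X * ?Y + a * c * ?Y * ?X
      + of_nat CARD('n) * (c * c * ?X * ?Y) + a * c * ?P + c * c * ?Y * ?X
      + c * (a * ?P + c * (?X * ?Y + ?Y * ?X))"
    unfolding E.killing_form_def endo_trace_vec[OF lin]
    by (simp add: sum.distrib simplicial_mult_nth[OF c] a_def[symmetric]
        flip: sum_distrib_left sum_distrib_right)
  also have "\<dots> = a * (a + 2 * c) * ?P
      + c * (2 * a + 4 * c + c * (of_nat CARD('n) - 1)) * ?X * ?Y"
    by (simp add: algebra_simps)
  also have "\<dots> = simplicial_form c x y"
    by (simp only: c) (simp add: a_def simplicial_form_def)
  finally show ?thesis .
qed

text \<open>
  With \<open>X\<close> the sum of the coordinates, orthogonality to all generators says \<open>(n + 1) xi = X\<close> for all \<open>i\<close>.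
  Summing over \<open>i\<close> gives \<open>X = 0\<close>, and then \<open>x = 0\<close> because \<open>n + 1 \<noteq> 0\<close> in characteristic zero.
\<close>

lemma simplicial_form_nondegenerate:
  fixes x :: "'k::field_char_0 ^ 'n::finite"
  assumes c: "c * (of_nat CARD('n) - 1) = - 1"
    and x: "\<And>i. simplicial_form c (axis i 1) x = 0"
  shows "x = 0"
proof -
  define N :: 'k where "N = of_nat CARD('n)"
  define X where "X = (\<Sum>i\<in>UNIV. x $ i)"
  have N: "N + 1 \<noteq> 0"
    unfolding N_def using of_nat_neq_0[of "CARD('n)"] by (simp add: add.commute)
  have c': "c * (N - 1) = - 1" using c by (simp add: N_def)
  have eq: "(N + 1) * x $ i = X" for i
  proof -
    have "(N - 1 - 2 * (c * (N - 1))) * x $ i + c * (N - 1) * X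
        = (N - 1) * ((1 - 2 * c) * x $ i + c * X)"
      by (simp add: algebra_simps)
    also have "\<dots> = 0"
      using x[of i] by (simp add: simplicial_form_axis X_def)
    finally show ?thesis by (simp add: c' add.commute)
  qed
  have "(N + 1) * X = (\<Sum>i::'n\<in>UNIV. X)"
    by (subst X_def) (simp only: sum_distrib_left eq)
  then have "X = 0" by (simp add: N_def algebra_simps)
  then show ?thesis using eq N by (simp add: vec_eq_iff)
qed

text \<open>
  The expression on the right is symmetric in \<open>x\<close>, \<open>y\<close> and \<open>z\<close>, which is the invariance of the form.
\<close>

lemma simplicial_form_mult:
  fixes x y z :: "'k::field ^ 'n::finite"
  assumes c: "c * (of_nat CARD('n) - 1) = - 1"
  defines "a \<equiv> 1 - 2 * c"
    and "X \<equiv> (\<Sum>i\<in>UNIV. x $ i)" and "Y \<equiv> (\<Sum>i\<in>UNIV. y $ i)" and "Z \<equiv> (\<Sum>i\<in>UNIV. z $ i)"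
  shows "simplicial_form c (simplicial_mult x y) z
    = a * a * (\<Sum>i\<in>UNIV. x $ i * y $ i * z $ i)
      + a * c * (X * (\<Sum>i\<in>UNIV. y $ i * z $ i) + Y * (\<Sum>i\<in>UNIV. x $ i * z $ i)
          + Z * (\<Sum>i\<in>UNIV. x $ i * y $ i))
      + 2 * c * c * (X * Y * Z)"
proof -
  have nth: "simplicial_mult x y $ i = a * (x $ i * y $ i) + c * (x $ i * Y + y $ i * X)" for i
    unfolding a_def X_def Y_def by (rule simplicial_mult_nth[OF c])
  have "(\<Sum>i\<in>UNIV. simplicial_mult x y $ i)
      = a * (\<Sum>i\<in>UNIV. x $ i * y $ i) + c * (X * Y + Y * X)"
    unfolding nth
    by (simp add: sum.distrib flip: sum_distrib_left sum_distrib_right)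
      (simp add: X_def Y_def mult.commute)
  moreover have "(\<Sum>i\<in>UNIV. simplicial_mult x y $ i * z $ i) = a * (\<Sum>i\<in>UNIV. x $ i * y $ i * z $ i)
      + c * (X * (\<Sum>i\<in>UNIV. y $ i * z $ i) + Y * (\<Sum>i\<in>UNIV. x $ i * z $ i))"
    unfolding nth by (simp add: sum.distrib sum_distrib_left algebra_simps)
  ultimately show ?thesis
    by (simp add: simplicial_form_def Z_def[symmetric] a_def[symmetric])
      (simp add: algebra_simps)
qed

lemma killing_metrized_simplicial:
  fixes c :: "'k::field_char_0"
  assumes c: "c * (of_nat CARD('n) - 1) = - 1"
  shows "killing_metrized_algebra (*s) (simplicial_mult :: 'k ^ 'n::finite \<Rightarrow> _)"
proof -
  interpret E: commutative_algebra "(*s)" "simplicial_mult :: 'k ^ 'n \<Rightarrow> _"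
    by (rule commutative_algebra_simplicial)
  show ?thesis
  proof unfold_locales
    fix x :: "'k ^ 'n" assume "\<And>y. E.killing_form x y = 0"
    then have "simplicial_form c x y = 0" for y
      by (simp add: killing_form_simplicial[OF c])
    then have "simplicial_form c (axis i 1) x = 0" for i
      by (metis simplicial_form_commute)
    then show "x = 0" by (rule simplicial_form_nondegenerate[OF c])
  next
    fix x y z :: "'k ^ 'n"
    show "E.killing_form (simplicial_mult x y) z = E.killing_form x (simplicial_mult y z)"
      unfolding killing_form_simplicial[OF c] simplicial_form_commute[of c x]
      by (simp add: simplicial_form_mult[OF c] algebra_simps)
  qed
qed

text \<open>
  A nonzero element of an ideal has a nonzero pairing with some generator, and then
  \<open>simplicial_mult_gen_left\<close> puts this generator into the ideal. Any two distinct generators pair to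
  \<open>c \<noteq> 0\<close>, so the others follow in the same way.
\<close>

lemma simple_simplicial:
  fixes c :: "'k::field_char_0"
  assumes c: "c * (of_nat CARD('n) - 1) = - 1"
  shows "simple_algebra (*s) (simplicial_mult :: 'k ^ 'n::finite \<Rightarrow> _)"
proof -
  interpret E: commutative_algebra "(*s)" "simplicial_mult :: 'k ^ 'n \<Rightarrow> _"
    by (rule commutative_algebra_simplicial)
  have "c \<noteq> 0" using c by auto
  show ?thesis
  proof unfold_locales
    fix i :: 'n
    have "simplicial_mult (axis i 1) (axis i 1) = (axis i 1 :: 'k ^ 'n)"
      by (simp add: simplicial_mult_axis)
    then show "\<exists>x y :: 'k ^ 'n. simplicial_mult x y \<noteq> 0"
      by (metis axis_eq_0_iff zero_neq_one)
  next
    fix I :: "('k ^ 'n) set" assume I: "E.ideal I"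
    then have sub: "vec.subspace I" and mul: "\<And>a x. x \<in> I \<Longrightarrow> simplicial_mult a x \<in> I"
      unfolding E.ideal_def by blast+
    have coeff: "simplicial_form c (axis i 1) x *s axis i 1 \<in> I" if "x \<in> I" for x i
    proof -
      have "simplicial_mult (axis i 1) x - c *s x \<in> I"
        using that mul sub by (intro vec.subspace_diff vec.subspace_scale)
      then show ?thesis by (simp add: simplicial_mult_gen_left[OF c])
    qed
    show "I = {0} \<or> I = UNIV"
    proof (cases "I = {0}")
      case False
      then obtain x where x: "x \<in> I" "x \<noteq> 0"
        using vec.subspace_0[OF sub] by blast
      then obtain i where "simplicial_form c (axis i 1) x \<noteq> 0"
        using simplicial_form_nondegenerate[OF c] by blast
      then have "axis i 1 \<in> I"
        using vec.subspace_scale[OF sub coeff[OF x(1), of i], of "1 / simplicial_form c (axis i 1) x"]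
        by simp
      then have "simplicial_form c (axis j 1) (axis i 1) *s axis j 1 \<in> I" for j
        by (rule coeff)
      moreover have "simplicial_form c (axis j 1) (axis i 1) = c" if "j \<noteq> i" for j :: 'n
        using that by (simp add: simplicial_form_axis) (simp add: axis_def)
      ultimately have "c *s axis j 1 \<in> I" if "j \<noteq> i" for j
        using that by metis
      then have "axis j 1 \<in> I" for j
        using vec.subspace_scale[OF sub, of "c *s axis j 1" "1 / c"] \<open>c \<noteq> 0\<close> \<open>axis i 1 \<in> I\<close>
        by (cases "j = i") auto
      then have "(\<Sum>j\<in>UNIV. y $ j *s axis j 1) \<in> I" for y
        using sub by (intro vec.subspace_sum vec.subspace_scale) auto
      then show ?thesis by (auto simp: basis_expansion)
    qed simp
  qed
qed


section \<open>The triple as a tensor product\<close>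

text \<open>
  The vertices of the tetrahedron are \<open>(1, 1, 1)\<close>, \<open>(1, -1, -1)\<close>, \<open>(-1, 1, -1)\<close> and \<open>(-1, -1, 1)\<close> in the
  coordinates of the triple of the ground field, with \<open>None\<close> indexing the first. So the
  midpoints of the edges at this vertex are the coordinate vectors there.
\<close>

definition edge_midpoint :: "3 \<Rightarrow> 'k::field ^ 3" where
  "edge_midpoint r = (1 / 2) *s (simplex_gen None + simplex_gen (Some r))"

lemma edge_midpoint_nth:
  "edge_midpoint r $ j = (if r = j then 0 else - (1 / 2 :: 'k::field_char_0))"
  using exhaust_3[of j] exhaust_3[of r]
  by (auto simp: edge_midpoint_def simplex_gen_def sum_3 axis_def)

lemma simplicial_mult_edge_midpoint:
  "simplicial_mult (edge_midpoint r) (edge_midpoint r) = (0 :: 'k::field_char_0 ^ 3)"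
  "simplicial_mult (edge_midpoint 1) (edge_midpoint 2) = (1 / 2) *s (edge_midpoint 3 :: 'k ^ 3)"
  "simplicial_mult (edge_midpoint 2) (edge_midpoint 3) = (1 / 2) *s (edge_midpoint 1 :: 'k ^ 3)"
  "simplicial_mult (edge_midpoint 3) (edge_midpoint 1) = (1 / 2) *s (edge_midpoint 2 :: 'k ^ 3)"
proof -
  have c: "- (1 / 2) * (of_nat CARD(3) - 1) = (- 1 :: 'k)" by simp
  note nth = simplicial_mult_nth[OF c] edge_midpoint_nth sum_3
  show "simplicial_mult (edge_midpoint r) (edge_midpoint r) = (0 :: 'k ^ 3)"
    using exhaust_3[of r] by (auto simp: vec_eq_iff forall_3 nth)
  show "simplicial_mult (edge_midpoint 1) (edge_midpoint 2) = (1 / 2) *s (edge_midpoint 3 :: 'k ^ 3)"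
    "simplicial_mult (edge_midpoint 2) (edge_midpoint 3) = (1 / 2) *s (edge_midpoint 1 :: 'k ^ 3)"
    "simplicial_mult (edge_midpoint 3) (edge_midpoint 1) = (1 / 2) *s (edge_midpoint 2 :: 'k ^ 3)"
    by (simp_all add: vec_eq_iff forall_3 nth)
qed

text \<open>
  The map \<open>(x1, x2, x3) \<mapsto> \<Sum>r. ur \<otimes> xr\<close>, with \<open>ur\<close> the edge midpoints, is multiplicative because the \<open>ur\<close>
  multiply like the coordinate vectors of the triple of the ground field. Its inverse expresses the
  vertices in terms of the midpoints: the vertex \<open>Some r\<close> is \<open>ur\<close> minus the two other
  midpoints.
\<close>

lemma triple_isomorphic_tensor:
  fixes m :: "'k::field_char_0 ^ 'n::finite \<Rightarrow> 'k ^ 'n \<Rightarrow> 'k ^ 'n"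
  assumes "commutative_algebra (*s) m"
  shows "algebra_isomorphic (triple_scale (*s)) (triple_mult (*s) m)
    (*s) (tensor_mult (simplicial_mult :: 'k ^ 3 \<Rightarrow> _) m)"
proof -
  interpret A: commutative_algebra_char_not_2 "(*s)" m
    using assms by (simp add: commutative_algebra_char_not_2_def commutative_algebra_char_not_2_axioms_def)
  define f :: "_ \<Rightarrow> 'k ^ (3 \<times> 'n)" where
    "f = (\<lambda>(x1, x2, x3). tensor (edge_midpoint 1) x1 + tensor (edge_midpoint 2) x2
      + tensor (edge_midpoint 3) x3)"
  define g :: "'k ^ (3 \<times> 'n) \<Rightarrow> _" where
    "g y = (\<chi> j. y $ (1, j) - y $ (2, j) - y $ (3, j), \<chi> j. y $ (2, j) - y $ (1, j) - y $ (3, j),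
      \<chi> j. y $ (3, j) - y $ (1, j) - y $ (2, j))" for y
  interpret L: Vector_Spaces.linear "(*s)" "(*s)" "tensor_mult (simplicial_mult :: 'k ^ 3 \<Rightarrow> _) m x" for x
    by (rule linear_tensor_mult)
  interpret R: Vector_Spaces.linear "(*s)" "(*s)" "\<lambda>x. tensor_mult (simplicial_mult :: 'k ^ 3 \<Rightarrow> _) m x y" for y
    by (rule linear_tensor_mult)
  interpret tensor: Vector_Spaces.linear "(*s)" "(*s)" "tensor a" for a :: "'k ^ 3"
    by (rule linear_tensor)
  interpret tensor': Vector_Spaces.linear "(*s)" "(*s)" "\<lambda>a. tensor a b" for b :: "'k ^ 'n"
    by (rule linear_tensor)
  have "g (f x) = x" for x
    by (cases x) (simp add: f_def g_def tensor_def edge_midpoint_nth vec_eq_iff field_simps)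
  moreover have "f (g y) = y" for y
    by (simp add: f_def g_def tensor_def edge_midpoint_nth vec_eq_iff split_paired_All forall_3 field_simps)
  ultimately have "bij f" by (metis bijI')
  moreover have "Vector_Spaces.linear (triple_scale (*s)) (*s) f"
  proof -
    interpret V: vector_space "triple_scale (*s) :: 'k \<Rightarrow> ('k^'n) \<times> ('k^'n) \<times> ('k^'n) \<Rightarrow> _"
      by (rule A.vector_space_triple)
    show ?thesis
      by unfold_locales
        (auto simp: f_def tensor.add tensor.scale vec.scale_right_distrib)
  qed
  moreover have "f (triple_mult (*s) m x y) = tensor_mult simplicial_mult m (f x) (f y)" for x y
  proof -
    obtain x1 x2 x3 y1 y2 y3 where xy: "x = (x1, x2, x3)" "y = (y1, y2, y3)"
      by (metis prod.exhaust)
    have pure: "tensor_mult simplicial_mult m (tensor a v) (tensor b w)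
        = tensor (simplicial_mult a b) (m v w)" for a b :: "'k ^ 3" and v w
      by (intro tensor_mult_tensor linear_simplicial_mult A.linear_mult_left A.linear_mult_right)
    show ?thesis
      by (simp add: xy A.triple_mult_eq f_def L.add R.add pure simplicial_mult_edge_midpoint
          simplicial_mult_commute[of "edge_midpoint 2" "edge_midpoint 1"]
          simplicial_mult_commute[of "edge_midpoint 3" "edge_midpoint 2"]
          simplicial_mult_commute[of "edge_midpoint 1" "edge_midpoint 3"]
          tensor.add tensor.scale tensor'.scale tensor'.zero vec.scale_right_distrib add_ac
          del: triple_mult.simps)
  qed
  ultimately show ?thesis unfolding algebra_isomorphic_def by blast
qed

theorem theorem11p19:
  fixes E3 :: "'k::field_char_0 ^ 3 \<Rightarrow> 'k ^ 3 \<Rightarrow> 'k ^ 3"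
    and En :: "'k ^ 'n::finite \<Rightarrow> 'k ^ 'n \<Rightarrow> 'k ^ 'n"
    and E3n :: "'k ^ (3 \<times> 'n) \<Rightarrow> 'k ^ (3 \<times> 'n) \<Rightarrow> 'k ^ (3 \<times> 'n)"
  defines "E3 \<equiv> simplicial_mult" and "En \<equiv> simplicial_mult" and "E3n \<equiv> simplicial_mult"
  defines "s \<equiv> triple_scale (*s)" and "T \<equiv> triple_mult (*s) En"
  assumes n: "CARD('n) \<ge> 2"
  shows "algebra_isomorphic s T (*s) (tensor_mult E3 En)
    \<and> exact_commutative_algebra s T
    \<and> killing_metrized_algebra s T
    \<and> simple_algebra s T
    \<and> \<not> algebra_isomorphic s T (*s) E3n"
proof -
  have coeff: "- 1 / (of_nat N - 1) * (of_nat N - 1) = (- 1 :: 'k)" if "N \<ge> 2" for N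
    using that of_nat_eq_iff[where 'a = 'k, of N 1] by simp
  interpret A: commutative_algebra_char_not_2 "(*s)" En
    using commutative_algebra_simplicial
    by (simp add: En_def commutative_algebra_char_not_2_def commutative_algebra_char_not_2_axioms_def)
  have line: "vec.span {e} \<noteq> UNIV" for e :: "'k ^ 'n"
  proof
    assume "vec.span {e} = UNIV"
    then have "vec.dim (UNIV :: ('k ^ 'n) set) \<le> card {e}"
      by (intro vec.dim_le_card) auto
    then show False using n by (simp add: card_cart_basis)
  qed
  have "CARD(3 \<times> 'n) \<ge> 2" using n by simp
  then have "\<not> algebra_isomorphic s T (*s) E3n"
    unfolding s_def T_def E3n_def
    by (intro A.triple_not_isomorphic_simplicial[OF coeff] line)
  moreover have "algebra_isomorphic s T (*s) (tensor_mult E3 En)"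
    unfolding s_def T_def E3_def by (intro triple_isomorphic_tensor A.commutative_algebra_axioms)
  moreover have "exact_commutative_algebra s T"
    unfolding s_def T_def by (rule A.exact_triple)
  moreover have "killing_metrized_algebra s T"
    using killing_metrized_simplicial[OF coeff[OF n]] unfolding s_def T_def
    by (intro A.killing_metrized_triple) (simp add: En_def)
  moreover have "simple_algebra s T"
    using simple_simplicial[OF coeff[OF n]] unfolding s_def T_def
    by (intro A.simple_triple) (simp add: En_def)
  ultimately show ?thesis by blast
qed

end
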